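(* Let $H:[0,\infty)\to\mathbb{R}$ be smooth, convex and super-linear (i.e. $H(x)/x\to\infty$ as $x\to\infty$), and set $A(x)=H(\|x\|)$ for $x\in\mathbb{R}^n$. Let $f:\mathbb{R}^n\to\mathbb{R}$ be Lipschitz continuous and let $f_*$ be its spherically symmetric increasing rearrangement. Let $u_t$ and $v_t$ be the solutions of the Hamilton–Jacobi problems $$\begin{cases}\partial_t u_t(x)+A(\nabla u_t(x))=0 & \text{in }\mathbb{R}^n\times(0,\infty)\\ u_0=f\end{cases}\qquad\text{and}\qquad\begin{cases}\partial_t v_t(x)+A(\nabla v_t(x))=0 & \text{in }\mathbb{R}^n\times(0,\infty)\\ v_0=f_*\end{cases}$$ respectively. Then, for all $t\ge 0$ and all $\lambda\in\mathbb{R}$, $$|\{v_t<\lambda\}|\ \le\ |\{u_t<\lambda\}|.$$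
   Context: $|\cdot|$ is Lebesgue measure and $\|\cdot\|$ the Euclidean norm on $\mathbb{R}^n$; the gradient acts on the space variable. Solution: the solution of the problem with initial datum $g$ is the one given by the Hopf–Lax formula $$Q_tg(x)=\inf_{y\in\mathbb{R}^n}\Big\{g(y)+t\,\mathcal{L}H\Big(\frac{\|x-y\|}{t}\Big)\Big\}\quad(t>0),\qquad Q_0g=g,$$ where $\mathcal{L}H(r)=\sup_{s\ge0}\{rs-H(s)\}$ is the Legendre transform of $H$. (In the paper, for Lipschitz $g$, this function is the generalized solution: Lipschitz, differentiable a.e., satisfying the equation a.e.; and the unique viscosity solution.) So $u_t=Q_tf$ and $v_t=Q_tf_*$. Rearrangement: for a Borel set $A\subseteq\mathbb{R}^n$, $A^*=\{x:\|x\|<r\}$ is the open ball centered at $0$ with $|A^*|=|A|$ (so $A^*=\emptyset$ if $|A|=0$ and $A^*=\mathbb{R}^n$ if $|A|=\infty$). For measurable $g\ge0$, $g^*(y)=\int_0^\infty\mathbf{1}_{\{g>s\}^*}(y)\,ds$, and $f_*=-\log\big((e^{-f})^*\big)$ (with $-\log0=+\infty$, $-\log\infty=-\infty$), so that $\{f_*<\lambda\}=\{f<\lambda\}^*$ for all $\lambda\in\mathbb{R}$. The convention $\infty\le\infty$ is used for measures. *)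

theory Defs
  imports "HOL-Analysis.Analysis"
begin

text \<open>Smoothness on the closed half-line, with one-sided derivatives of all orders at \<open>0\<close>.
  The values of \<open>H\<close> on the negative reals play no role here or below.\<close>

definition smooth_on_half_line :: "(real \<Rightarrow> real) \<Rightarrow> bool" where
  "smooth_on_half_line H \<longleftrightarrow>
     (\<exists>D :: nat \<Rightarrow> real \<Rightarrow> real. D 0 = H \<and>
        (\<forall>k. \<forall>x\<ge>0. (D k has_real_derivative D (Suc k) x) (at x within {0..})))"

definition superlinear :: "(real \<Rightarrow> real) \<Rightarrow> bool" where
  "superlinear H \<longleftrightarrow> filterlim (\<lambda>x. H x / x) at_top at_top"

definition legendre_transform :: "(real \<Rightarrow> real) \<Rightarrow> real \<Rightarrow> ereal" where
  "legendre_transform H r = (SUP s\<in>{0..}. ereal (r * s - H s))"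

text \<open>The Hopf--Lax solution, at time \<open>t \<ge> 0\<close>, of the Hamilton--Jacobi problem with Hamiltonian
  \<open>x \<mapsto> H (norm x)\<close> and initial datum \<open>g\<close>. The datum is extended-real-valued because the
  rearrangement of a real-valued function may take the value \<open>-\<infinity>\<close> (e.g. for a nonzero linear
  function). For superlinear \<open>H\<close> convex on the half-line, the Legendre transform is finite, so no
  sum \<open>-\<infinity> + \<infinity>\<close> occurs.\<close>

definition hopf_lax ::
  "(real \<Rightarrow> real) \<Rightarrow> real \<Rightarrow> ('a::euclidean_space \<Rightarrow> ereal) \<Rightarrow> 'a \<Rightarrow> ereal" where
  "hopf_lax H t g x =
     (if t = 0 then g x
      else (INF y. g y + ereal t * legendre_transform H (norm (x - y) / t)))"

text \<open>If \<open>A\<close> is a null set, the radius is \<open>0\<close> and the ball is empty.\<close>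

definition set_rearrangement :: "'a::euclidean_space set \<Rightarrow> 'a set" where
  "set_rearrangement A =
     (if emeasure lebesgue A = \<infinity> then UNIV
      else ball 0 (THE r. 0 \<le> r \<and> emeasure lebesgue (ball (0::'a) r) = emeasure lebesgue A))"

definition decreasing_rearrangement :: "('a::euclidean_space \<Rightarrow> ennreal) \<Rightarrow> 'a \<Rightarrow> ennreal" where
  "decreasing_rearrangement g y =
     (\<integral>\<^sup>+s\<in>{0<..}. indicator (set_rearrangement {x. g x > ennreal s}) y \<partial>lborel)"

definition neg_ln :: "ennreal \<Rightarrow> ereal" where
  "neg_ln a = (if a = 0 then \<infinity> else if a = \<infinity> then - \<infinity> else ereal (- ln (enn2real a)))"

definition increasing_rearrangement :: "('a::euclidean_space \<Rightarrow> real) \<Rightarrow> 'a \<Rightarrow> ereal" where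
  "increasing_rearrangement f y =
     neg_ln (decreasing_rearrangement (\<lambda>x. ennreal (exp (- f x))) y)"

end

theory Submission
  imports Defs
begin

text \<open>At a positive time, the sublevel set \<open>{u < l}\<close> of a Hopf--Lax solution is a union of neighbourhoods of
sublevel sets of the initial datum: a point is in it if and only if, for some \<open>m\<close>, it is reached from a
point where the datum is below \<open>m\<close> by a move of cost at most \<open>l - m\<close>. The cost
is a nondecreasing function of the length of the move, so the points that can be reached at a given cost
form a neighbourhood of some radius \<open>d\<close>. Rearranging the datum replaces
\<open>{f < m}\<close> by the centred ball of the same volume (the whole space, if that volume is infinite), and among all sets of that volume
the ball has the smallest \<open>d\<close>-neighbourhoods. So each neighbourhood that contributes to \<open>{v < l}\<close> is a
centred ball with at most the volume of \<open>{u < l}\<close>, hence is contained in the rearrangement of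
\<open>{u < l}\<close> (lemma \<open>hopf_lax_sublevel_subset_rearrangement\<close>), which has the volume of \<open>{u < l}\<close>.
At time 0 the same inclusion says that \<open>{f\<^sub>* < l}\<close> is contained in the rearrangement of \<open>{f < l}\<close>.

The geometric core is the minimality of the ball, \<open>emeasure_ball_add_le_emeasure_set_plus_cball\<close>. It is a
case of the Brunn--Minkowski inequality, which is proved here for open sets of finite volume by the
method of Hadwiger and Ohmann: the arithmetic-geometric mean inequality for single boxes
(\<open>brunn_minkowski_box\<close>), an induction on the number of boxes for finite disjoint unions
(\<open>brunn_minkowski_box_family\<close>), and exhaustion from inside (\<open>brunn_minkowski_open\<close>).\<close>

section \<open>Minkowski sums of boxes\<close>

text \<open>This is the Brunn--Minkowski inequality for two boxes with side lengths \<open>p\<close> and \<open>q\<close>. After division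
by the right-hand side it becomes additive: the arithmetic-geometric mean inequality bounds the two
normalized roots by the averages of \<open>p i / (p i + q i)\<close> and of \<open>q i / (p i + q i)\<close>, which add up
to 1.\<close>
lemma sum_root_prod_le_root_prod_add:
  fixes p q :: "'a \<Rightarrow> real"
  assumes "finite S" "S \<noteq> {}" and p: "\<And>i. i \<in> S \<Longrightarrow> p i > 0" and q: "\<And>i. i \<in> S \<Longrightarrow> q i > 0"
  shows "root (card S) (\<Prod>i\<in>S. p i) + root (card S) (\<Prod>i\<in>S. q i) \<le> root (card S) (\<Prod>i\<in>S. p i + q i)"
proof -
  let ?n = "card S"
  have n: "?n > 0" using assms by (simp add: card_gt_0_iff)
  have amgm: "root ?n (\<Prod>i\<in>S. r i / (p i + q i)) \<le> (\<Sum>i\<in>S. r i / (p i + q i)) / ?n"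
    if "\<And>i. i \<in> S \<Longrightarrow> r i > 0" for r
  proof -
    have nn: "r i / (p i + q i) \<ge> 0" if "i \<in> S" for i
      using \<open>\<And>i. i \<in> S \<Longrightarrow> r i > 0\<close>[OF that] p[OF that] q[OF that] by simp
    then show ?thesis
      using arith_geom_mean[OF assms(1,2), of "\<lambda>i. r i / (p i + q i)"] n
      by (simp add: root_powr_inverse prod_nonneg sum_divide_distrib)
  qed
  let ?P = "root ?n (\<Prod>i\<in>S. p i + q i)"
  have P: "?P > 0"
    using n p q by (simp add: prod_pos add_pos_pos)
  have "root ?n (\<Prod>i\<in>S. p i) / ?P + root ?n (\<Prod>i\<in>S. q i) / ?P
      = root ?n (\<Prod>i\<in>S. p i / (p i + q i)) + root ?n (\<Prod>i\<in>S. q i / (p i + q i))"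
    by (simp add: prod_dividef real_root_divide)
  also have "\<dots> \<le> (\<Sum>i\<in>S. p i / (p i + q i)) / ?n + (\<Sum>i\<in>S. q i / (p i + q i)) / ?n"
    by (intro add_mono amgm p q)
  also have "\<dots> = (\<Sum>i\<in>S. p i / (p i + q i) + q i / (p i + q i)) / ?n"
    by (simp add: sum.distrib add_divide_distrib)
  also have "(\<Sum>i\<in>S. p i / (p i + q i) + q i / (p i + q i)) = (\<Sum>i\<in>S. 1)"
    using p q by (intro sum.cong refl) (metis add_divide_distrib add_pos_pos div_self less_irrefl)
  finally have "(root ?n (\<Prod>i\<in>S. p i) + root ?n (\<Prod>i\<in>S. q i)) / ?P \<le> 1"
    using n by (simp add: add_divide_distrib)
  with P show ?thesis
    by (simp add: field_simps)
qed

lemma set_plus_box: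
  fixes a b c d :: "'a::euclidean_space"
  assumes ab: "box a b \<noteq> {}" and cd: "box c d \<noteq> {}"
  shows "box a b + box c d = box (a + c) (b + d)"
proof
  show "box a b + box c d \<subseteq> box (a + c) (b + d)"
    by (auto simp: set_plus_def mem_box inner_add_left intro!: add_strict_mono)
  show "box (a + c) (b + d) \<subseteq> box a b + box c d"
  proof
    fix x assume x: "x \<in> box (a + c) (b + d)"
    \<comment> \<open>Coordinate by coordinate, \<open>x\<close> sits at relative height \<open>s i\<close> in the interval of the sum; the summands
      at the same relative height in their own intervals add up to it.\<close>
    have ab': "a \<bullet> i < b \<bullet> i" and cd': "c \<bullet> i < d \<bullet> i" if "i \<in> Basis" for i
      using ab cd that by (auto simp: box_ne_empty)
    define s where "s i = (x \<bullet> i - a \<bullet> i - c \<bullet> i) / (b \<bullet> i - a \<bullet> i + (d \<bullet> i - c \<bullet> i))" for i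
    have s: "0 < s i" "s i < 1" "s i * (b \<bullet> i - a \<bullet> i + (d \<bullet> i - c \<bullet> i)) = x \<bullet> i - a \<bullet> i - c \<bullet> i"
      if "i \<in> Basis" for i
    proof -
      have *: "b \<bullet> i - a \<bullet> i + (d \<bullet> i - c \<bullet> i) > 0"
        "x \<bullet> i - a \<bullet> i - c \<bullet> i > 0"
        "x \<bullet> i - a \<bullet> i - c \<bullet> i < b \<bullet> i - a \<bullet> i + (d \<bullet> i - c \<bullet> i)"
        using ab'[OF that] cd'[OF that] x that by (auto simp: mem_box inner_add_left)
      then show "0 < s i" "s i < 1" "s i * (b \<bullet> i - a \<bullet> i + (d \<bullet> i - c \<bullet> i)) = x \<bullet> i - a \<bullet> i - c \<bullet> i"
        unfolding s_def by simp_all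
    qed
    define y where "y = (\<Sum>i\<in>Basis. (a \<bullet> i + s i * (b \<bullet> i - a \<bullet> i)) *\<^sub>R i)"
    have y: "y \<bullet> i = a \<bullet> i + s i * (b \<bullet> i - a \<bullet> i)" if "i \<in> Basis" for i
      using that by (simp add: y_def)
    have "y \<in> box a b"
      unfolding mem_box
    proof
      fix i :: 'a assume i: "i \<in> Basis"
      have "0 < s i * (b \<bullet> i - a \<bullet> i)" "s i * (b \<bullet> i - a \<bullet> i) < 1 * (b \<bullet> i - a \<bullet> i)"
        using s[OF i] ab'[OF i] by (simp, intro mult_strict_right_mono, auto)
      then show "a \<bullet> i < y \<bullet> i \<and> y \<bullet> i < b \<bullet> i"
        using y[OF i] by simp
    qed
    moreover have "x - y \<in> box c d"
      unfolding mem_box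
    proof
      fix i :: 'a assume i: "i \<in> Basis"
      have "0 < s i * (d \<bullet> i - c \<bullet> i)" "s i * (d \<bullet> i - c \<bullet> i) < 1 * (d \<bullet> i - c \<bullet> i)"
        using s[OF i] cd'[OF i] by (simp, intro mult_strict_right_mono, auto)
      moreover have "(x - y) \<bullet> i = c \<bullet> i + s i * (d \<bullet> i - c \<bullet> i)"
        using y[OF i] s(3)[OF i] by (simp add: inner_diff_left algebra_simps)
      ultimately show "c \<bullet> i < (x - y) \<bullet> i \<and> (x - y) \<bullet> i < d \<bullet> i"
        by simp
    qed
    ultimately show "x \<in> box a b + box c d"
      by (metis add.commute diff_add_cancel set_plus_intro)
  qed
qed

lemma brunn_minkowski_box:
  fixes a b c d :: "'a::euclidean_space"
  assumes ab: "box a b \<noteq> {}" and cd: "box c d \<noteq> {}"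
  shows "root DIM('a) (measure lborel (box a b)) + root DIM('a) (measure lborel (box c d))
    \<le> root DIM('a) (measure lborel (box a b + box c d))"
proof -
  have ab': "a \<bullet> i < b \<bullet> i" and cd': "c \<bullet> i < d \<bullet> i" if "i \<in> Basis" for i
    using ab cd that by (auto simp: box_ne_empty)
  have "measure lborel (box a b) = (\<Prod>i\<in>Basis. (b - a) \<bullet> i)"
    "measure lborel (box c d) = (\<Prod>i\<in>Basis. (d - c) \<bullet> i)"
    using ab' cd' by (simp_all add: less_imp_le)
  moreover have "measure lborel (box a b + box c d) = (\<Prod>i\<in>Basis. (b + d - (a + c)) \<bullet> i)"
    unfolding set_plus_box[OF ab cd] using ab' cd'
    by (intro measure_lborel_box) (simp add: inner_add_left add_mono less_imp_le)
  moreover have "(\<Prod>i\<in>Basis. (b + d - (a + c)) \<bullet> i) = (\<Prod>i\<in>Basis. (b - a) \<bullet> i + (d - c) \<bullet> i)"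
    by (simp add: inner_diff_left inner_add_left algebra_simps)
  ultimately show ?thesis
    using sum_root_prod_le_root_prod_add[of "Basis :: 'a set" "\<lambda>i. (b - a) \<bullet> i" "\<lambda>i. (d - c) \<bullet> i"] ab' cd'
    by (simp add: inner_diff_left)
qed

section \<open>Finite disjoint families of boxes\<close>
lemma box_Int_halfspace_lt:
  assumes "k \<in> Basis"
  shows "box a b \<inter> {x. x \<bullet> k < c} = box a (\<Sum>i\<in>Basis. (if i = k then min (b \<bullet> k) c else b \<bullet> i) *\<^sub>R i)"
  using assms by (intro set_eqI) (auto simp: mem_box)

lemma box_Int_halfspace_gt:
  assumes "k \<in> Basis"
  shows "box a b \<inter> {x. x \<bullet> k > c} = box (\<Sum>i\<in>Basis. (if i = k then max (a \<bullet> k) c else a \<bullet> i) *\<^sub>R i) b"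
  using assms by (intro set_eqI) (auto simp: mem_box)

text \<open>The boxes are open, so that Minkowski sums of their unions are open as well, hence measurable; they are
nonempty, so that a nonempty family has positive volume.\<close>
definition box_family :: "'a::euclidean_space set set \<Rightarrow> bool" where
  "box_family \<D> \<longleftrightarrow> finite \<D> \<and> disjoint \<D> \<and> (\<forall>K\<in>\<D>. K \<noteq> {} \<and> (\<exists>a b. K = box a b))"

lemma box_familyE:
  assumes "box_family \<D>" "K \<in> \<D>"
  obtains a b where "K = box a b" "box a b \<noteq> {}"
  using assms unfolding box_family_def by blast

lemma open_Union_box_family: "box_family \<D> \<Longrightarrow> open (\<Union>\<D>)"
  unfolding box_family_def by (metis open_Union open_box)

lemma bounded_Union_box_family: "box_family \<D> \<Longrightarrow> bounded (\<Union>\<D>)"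
  unfolding box_family_def by (metis bounded_Union bounded_box)

lemma open_bounded_fmeasurable_lborel:
  fixes S :: "'a::euclidean_space set"
  shows "open S \<Longrightarrow> bounded S \<Longrightarrow> S \<in> fmeasurable lborel"
  by (metis borel_open fmeasurable_cbox fmeasurableI2 sets_lborel bounded_subset_cbox_symmetric)

lemma Union_box_family_fmeasurable: "box_family \<D> \<Longrightarrow> \<Union>\<D> \<in> fmeasurable lborel"
  by (simp add: open_bounded_fmeasurable_lborel open_Union_box_family bounded_Union_box_family)

lemma measure_Union_box_family_pos:
  assumes "box_family \<D>" "\<D> \<noteq> {}"
  shows "measure lborel (\<Union>\<D>) > 0"
proof -
  obtain K where "K \<in> \<D>" using assms(2) by blast
  then obtain a b where "box a b \<in> \<D>" and ne: "box a b \<noteq> {}"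
    using box_familyE[OF assms(1)] by metis
  have ab: "a \<bullet> i < b \<bullet> i" if "i \<in> Basis" for i
    using ne that by (auto simp: box_ne_empty)
  have "0 < (\<Prod>i\<in>Basis. (b - a) \<bullet> i)"
    using ab by (intro prod_pos) (simp add: inner_diff_left)
  also have "\<dots> = measure lborel (box a b)"
    using ab by (intro measure_lborel_box[symmetric] less_imp_le)
  also have "\<dots> \<le> measure lborel (\<Union>\<D>)"
    using \<open>box a b \<in> \<D>\<close> assms
    by (intro measure_mono_fmeasurable Union_box_family_fmeasurable) auto
  finally show ?thesis .
qed

lemma box_family_Int:
  assumes "box_family \<D>" and H: "\<And>a b. \<exists>a' b'. box a b \<inter> H = box a' b'"
  shows "box_family ((\<lambda>K. K \<inter> H) ` \<D> - {{}})"
  unfolding box_family_def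
proof (intro conjI ballI)
  show "finite ((\<lambda>K. K \<inter> H) ` \<D> - {{}})"
    using assms by (simp add: box_family_def)
  show "disjoint ((\<lambda>K. K \<inter> H) ` \<D> - {{}})"
  proof (intro disjointI)
    fix K L assume "K \<in> (\<lambda>K. K \<inter> H) ` \<D> - {{}}" "L \<in> (\<lambda>K. K \<inter> H) ` \<D> - {{}}" "K \<noteq> L"
    then obtain K' L' where "K' \<in> \<D>" "L' \<in> \<D>" "K' \<noteq> L'" "K = K' \<inter> H" "L = L' \<inter> H" by blast
    moreover from this have "K' \<inter> L' = {}"
      using assms(1) by (simp add: box_family_def disjoint_def)
    ultimately show "K \<inter> L = {}" by blast
  qed
  fix K assume "K \<in> (\<lambda>K. K \<inter> H) ` \<D> - {{}}"
  then obtain L where L: "L \<in> \<D>" "K = L \<inter> H" "K \<noteq> {}" by blast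
  obtain a b where "K = box a b \<inter> H"
    using box_familyE[OF assms(1) L(1)] L(2) by metis
  with L(3) H[of a b] show "K \<noteq> {}" "\<exists>a b. K = box a b" by simp_all
qed

text \<open>Disjoint boxes have disjoint projections to some coordinate axis, so a face of one of them yields the
hyperplane.\<close>
lemma separate_disjoint_boxes:
  fixes K L :: "'a::euclidean_space set"
  assumes "K = box a b" "L = box a' b'" "K \<noteq> {}" "L \<noteq> {}" "K \<inter> L = {}"
  obtains k c where "k \<in> Basis" 
    "K \<subseteq> {x. x \<bullet> k < c} \<and> L \<subseteq> {x. x \<bullet> k > c} \<or> L \<subseteq> {x. x \<bullet> k < c} \<and> K \<subseteq> {x. x \<bullet> k > c}"
proof -
  obtain k where k: "k \<in> Basis" "b \<bullet> k \<le> a' \<bullet> k \<or> b' \<bullet> k \<le> a \<bullet> k"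
    using assms by (force simp: disjoint_interval box_ne_empty)
  have K: "a \<bullet> k < x \<bullet> k" "x \<bullet> k < b \<bullet> k" if "x \<in> K" for x
    using that k assms by (auto simp: mem_box)
  have L: "a' \<bullet> k < x \<bullet> k" "x \<bullet> k < b' \<bullet> k" if "x \<in> L" for x
    using that k assms by (auto simp: mem_box)
  from k(2) show ?thesis
  proof
    assume "b \<bullet> k \<le> a' \<bullet> k"
    then have "K \<subseteq> {x. x \<bullet> k < b \<bullet> k} \<and> L \<subseteq> {x. x \<bullet> k > b \<bullet> k}"
      using K L by force
    with that k(1) show ?thesis by blast
  next
    assume "b' \<bullet> k \<le> a \<bullet> k"
    then have "L \<subseteq> {x. x \<bullet> k < b' \<bullet> k} \<and> K \<subseteq> {x. x \<bullet> k > b' \<bullet> k}"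
      using K L by force
    with that k(1) show ?thesis by blast
  qed
qed

lemma measure_split_hyperplane:
  fixes S :: "'a::euclidean_space set"
  assumes S: "S \<in> fmeasurable lborel" and k: "k \<in> Basis"
  shows "measure lborel S = measure lborel (S \<inter> {x. x \<bullet> k < c}) + measure lborel (S \<inter> {x. x \<bullet> k > c})"
proof -
  have meas: "S \<inter> {x. x \<bullet> k < c} \<in> fmeasurable lborel" "S \<inter> {x. x \<bullet> k > c} \<in> fmeasurable lborel"
    using S by (auto intro!: fmeasurable_Int_fmeasurable)
  have "{x::'a. x \<bullet> k = c} \<in> null_sets lborel"
    using negligible_standard_hyperplane[OF k, of c]
    by (simp add: negligible_iff_null_sets null_sets_completion_iff)
  then have "AE x in lborel. x \<bullet> k \<noteq> c"
    by (simp add: AE_iff_null_sets)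
  then have "measure lborel S = measure lborel ((S \<inter> {x. x \<bullet> k < c}) \<union> (S \<inter> {x. x \<bullet> k > c}))"
    using S meas by (intro measure_eq_AE) auto
  also have "\<dots> = measure lborel (S \<inter> {x. x \<bullet> k < c}) + measure lborel (S \<inter> {x. x \<bullet> k > c})"
    using meas by (intro measure_Un2[THEN trans]) (auto intro!: arg_cong[where f="measure lborel"])
  finally show ?thesis .
qed

text \<open>Moving the hyperplane changes a single side length of the truncated box, and that length depends
continuously on the position.\<close>
lemma continuous_measure_box_Int_halfspace:
  fixes a b :: "'a::euclidean_space"
  assumes k: "k \<in> Basis"
  shows "continuous_on UNIV (\<lambda>c. measure lborel (box a b \<inter> {x. x \<bullet> k < c}))"
proof (cases "box a b = {}")
  case False
  then have ab: "a \<bullet> i < b \<bullet> i" if "i \<in> Basis" for i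
    using that by (auto simp: box_ne_empty)
  have "measure lborel (box a b \<inter> {x. x \<bullet> k < c})
      = max 0 (min (b \<bullet> k) c - a \<bullet> k) * (\<Prod>i\<in>Basis - {k}. (b - a) \<bullet> i)" for c
  proof (cases "a \<bullet> k \<le> c")
    case True
    let ?b = "\<Sum>i\<in>Basis. (if i = k then min (b \<bullet> k) c else b \<bullet> i) *\<^sub>R i"
    have "measure lborel (box a ?b) = (\<Prod>i\<in>Basis. (?b - a) \<bullet> i)"
      using True ab by (intro measure_lborel_box) (auto simp: less_imp_le)
    also have "\<dots> = (?b - a) \<bullet> k * (\<Prod>i\<in>Basis - {k}. (?b - a) \<bullet> i)"
      using k by (simp add: prod.remove)
    also have "(\<Prod>i\<in>Basis - {k}. (?b - a) \<bullet> i) = (\<Prod>i\<in>Basis - {k}. (b - a) \<bullet> i)"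
      by (intro prod.cong refl) (simp add: inner_diff_left)
    also have "(?b - a) \<bullet> k = max 0 (min (b \<bullet> k) c - a \<bullet> k)"
      using k True ab[OF k] by (simp add: inner_diff_left)
    finally show ?thesis
      by (simp only: box_Int_halfspace_lt[OF k])
  next
    case False
    then have "box a b \<inter> {x. x \<bullet> k < c} = {}"
      using k by (force simp: mem_box)
    with False show ?thesis by simp
  qed
  then show ?thesis
    by (simp only:) (intro continuous_intros)
qed auto

lemma measure_Union_box_family_Int:
  assumes "box_family \<D>" "H \<in> sets lborel"
  shows "measure lborel (\<Union>\<D> \<inter> H) = (\<Sum>K\<in>\<D>. measure lborel (K \<inter> H))"
proof -
  have "measure lborel (\<Union>K\<in>\<D>. K \<inter> H) = (\<Sum>K\<in>\<D>. measure lborel (K \<inter> H))"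
  proof (rule measure_finite_Union)
    show "disjoint_family_on (\<lambda>K. K \<inter> H) \<D>"
      using assms by (auto simp: box_family_def disjoint_family_on_def disjoint_def)
    show "(\<lambda>K. K \<inter> H) ` \<D> \<subseteq> sets lborel"
      using assms by (auto simp: box_family_def)
    show "emeasure lborel (K \<inter> H) \<noteq> \<infinity>" if K: "K \<in> \<D>" for K
    proof -
      obtain a b where "K = box a b" using box_familyE[OF assms(1) K] .
      then have "K \<inter> H \<in> fmeasurable lborel"
        using assms by (auto intro!: fmeasurable_Int_fmeasurable)
      then show ?thesis by (auto simp: fmeasurable_def)
    qed
  qed (use assms in \<open>auto simp: box_family_def\<close>)
  moreover have "(\<Union>K\<in>\<D>. K \<inter> H) = \<Union>\<D> \<inter> H" by auto
  ultimately show ?thesis by simp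
qed

text \<open>The volume below a hyperplane grows continuously from 0 to the total volume as the hyperplane moves
up, so the intermediate value theorem applies.\<close>
lemma cut_box_family_in_ratio:
  fixes \<D> :: "'a::euclidean_space set set"
  assumes D: "box_family \<D>" and k: "k \<in> Basis" and \<alpha>: "0 \<le> \<alpha>" "\<alpha> \<le> 1"
  obtains c where "measure lborel (\<Union>\<D> \<inter> {x. x \<bullet> k < c}) = \<alpha> * measure lborel (\<Union>\<D>)"
proof -
  let ?F = "\<lambda>c. measure lborel (\<Union>\<D> \<inter> {x. x \<bullet> k < c})"
  obtain B where B: "\<And>x. x \<in> \<Union>\<D> \<Longrightarrow> norm x \<le> B" "B > 0"
    using bounded_Union_box_family[OF D] unfolding bounded_pos by blast
  have xB: "-B \<le> x \<bullet> k" "x \<bullet> k \<le> B" if "x \<in> \<Union>\<D>" for x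
    using B(1)[OF that] Basis_le_norm[OF k, of x] by auto
  have lo: "\<Union>\<D> \<inter> {x. x \<bullet> k < -B} = {}"
    using xB(1) by (meson disjoint_iff mem_Collect_eq not_less)
  have hi: "\<Union>\<D> \<inter> {x. x \<bullet> k < B + 1} = \<Union>\<D>"
  proof (rule Int_absorb2, rule subsetI, rule CollectI)
    show "x \<bullet> k < B + 1" if "x \<in> \<Union>\<D>" for x
      using xB(2)[OF that] by linarith
  qed
  have cont: "continuous_on UNIV ?F"
  proof -
    have *: "continuous_on UNIV (\<lambda>c. measure lborel (K \<inter> {x. x \<bullet> k < c}))" if K: "K \<in> \<D>" for K
    proof -
      obtain a b where "K = box a b" using box_familyE[OF D K] .
      then show ?thesis using continuous_measure_box_Int_halfspace[OF k, of a b] by simp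
    qed
    have "?F = (\<lambda>c. \<Sum>K\<in>\<D>. measure lborel (K \<inter> {x. x \<bullet> k < c}))"
      using D by (intro ext measure_Union_box_family_Int) auto
    then show ?thesis
      by (simp only:) (rule continuous_on_sum[OF *])
  qed
  have 1: "?F (-B) \<le> \<alpha> * measure lborel (\<Union>\<D>)"
    unfolding lo using \<alpha> by simp
  have 2: "\<alpha> * measure lborel (\<Union>\<D>) \<le> ?F (B + 1)"
    unfolding hi using \<alpha> by (simp add: mult_left_le_one_le)
  have 3: "continuous_on {-B..B+1} ?F"
    by (rule continuous_on_subset[OF cont]) simp
  obtain c where "?F c = \<alpha> * measure lborel (\<Union>\<D>)"
    using IVT'[OF 1 2 _ 3] B by auto
  then show ?thesis by (rule that)
qed

lemma open_set_plus:
  fixes A B :: "'a::real_normed_vector set"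
  assumes "open A"
  shows "open (A + B)"
proof -
  have "A + B = (\<Union>x\<in>A. \<Union>y\<in>B. {x + y})" by (auto simp: set_plus_def)
  with open_sums[of A B] assms show ?thesis by simp
qed

section \<open>The Brunn--Minkowski inequality\<close>
lemma box_family_Int_halfspace:
  fixes \<D> :: "'a::euclidean_space set set"
  assumes "box_family \<D>" "k \<in> Basis"
  shows "box_family ((\<lambda>K. K \<inter> {x. x \<bullet> k < c}) ` \<D> - {{}})"
    and "box_family ((\<lambda>K. K \<inter> {x. x \<bullet> k > c}) ` \<D> - {{}})"
  by (intro box_family_Int[OF assms(1)] exI, rule box_Int_halfspace_lt[OF assms(2)])
    (intro box_family_Int[OF assms(1)] exI, rule box_Int_halfspace_gt[OF assms(2)])

lemma Union_image_Int_diff_empty: "\<Union>((\<lambda>K. K \<inter> H) ` \<D> - {{}}) = \<Union>\<D> \<inter> H"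
  by auto

lemma card_image_Int_diff_empty_less:
  assumes "finite \<D>" "K \<in> \<D>" "K \<inter> H = {}"
  shows "card ((\<lambda>K. K \<inter> H) ` \<D> - {{}}) < card \<D>"
proof -
  have "(\<lambda>K. K \<inter> H) ` \<D> - {{}} \<subseteq> (\<lambda>K. K \<inter> H) ` (\<D> - {K})"
    using assms(3) by auto
  then have "card ((\<lambda>K. K \<inter> H) ` \<D> - {{}}) \<le> card (\<D> - {K})"
    using assms by (meson card_image_le card_mono finite_Diff finite_imageI le_trans)
  with assms(1,2) show ?thesis
    by (meson card_Diff1_less le_less_trans)
qed

lemma card_image_Int_diff_empty_le:
  assumes "finite \<D>"
  shows "card ((\<lambda>K. K \<inter> H) ` \<D> - {{}}) \<le> card \<D>"
  by (meson assms card_image_le card_mono finite_imageI Diff_subset le_trans)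

text \<open>The induction step of Hadwiger and Ohmann. A hyperplane that separates two boxes of \<open>\<A>\<close> cuts \<open>\<A>\<close> into
two strictly smaller families. A parallel hyperplane cuts \<open>\<B>\<close> into parts whose volumes are in the
same ratio \<open>\<alpha> : 1 - \<alpha>\<close>, which does not increase the number of boxes. The sums of corresponding parts
lie on different sides of the hyperplane at height \<open>c + d\<close>, so their volumes add up to at most that of the
whole sum. Because the ratios agree, the two bounds of the induction hypothesis are the fractions
\<open>\<alpha>\<close> and \<open>1 - \<alpha>\<close> of the bound that is wanted.\<close>
lemma brunn_minkowski_box_family_step:
  fixes \<A> \<B> :: "'a::euclidean_space set set"
  assumes A: "box_family \<A>" and B: "box_family \<B>" "\<B> \<noteq> {}" and card: "card \<A> \<ge> 2"
    and IH: "\<And>\<A>' \<B>' :: 'a set set. box_family \<A>' \<Longrightarrow> \<A>' \<noteq> {} \<Longrightarrow> box_family \<B>' \<Longrightarrow> \<B>' \<noteq> {} \<Longrightarrow>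
      card \<A>' + card \<B>' < card \<A> + card \<B> \<Longrightarrow>
      (root DIM('a) (measure lborel (\<Union>\<A>')) + root DIM('a) (measure lborel (\<Union>\<B>'))) ^ DIM('a)
        \<le> measure lborel (\<Union>\<A>' + \<Union>\<B>')"
  shows "(root DIM('a) (measure lborel (\<Union>\<A>)) + root DIM('a) (measure lborel (\<Union>\<B>))) ^ DIM('a)
        \<le> measure lborel (\<Union>\<A> + \<Union>\<B>)"
proof -
  have finA: "finite \<A>" and finB: "finite \<B>" using A B by (auto simp: box_family_def)
  have "\<not> card \<A> \<le> Suc 0" using card by simp
  then obtain K L where KL: "K \<in> \<A>" "L \<in> \<A>" "K \<noteq> L"
    unfolding card_le_Suc0_iff_eq[OF finA] by blast
  obtain a b where K: "K = box a b" "box a b \<noteq> {}" using A KL(1) by (rule box_familyE)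
  obtain a' b' where L: "L = box a' b'" "box a' b' \<noteq> {}" using A KL(2) by (rule box_familyE)
  have "K \<inter> L = {}"
    using A KL by (simp add: box_family_def disjoint_def)
  then obtain k c where k: "k \<in> Basis" and "K \<subseteq> {x. x \<bullet> k < c} \<and> L \<subseteq> {x. x \<bullet> k > c} \<or>
      L \<subseteq> {x. x \<bullet> k < c} \<and> K \<subseteq> {x. x \<bullet> k > c}"
    using separate_disjoint_boxes[OF K(1) L(1)] K L by metis
  then obtain K1 K2 where K12: "K1 \<in> \<A>" "K2 \<in> \<A>" "K1 \<subseteq> {x. x \<bullet> k < c}" "K2 \<subseteq> {x. x \<bullet> k > c}"
    using KL by blast
  then have ne: "K1 \<noteq> {}" "K2 \<noteq> {}" using A by (auto simp: box_family_def)
  define \<A>1 where "\<A>1 = (\<lambda>K. K \<inter> {x. x \<bullet> k < c}) ` \<A> - {{}}"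
  define \<A>2 where "\<A>2 = (\<lambda>K. K \<inter> {x. x \<bullet> k > c}) ` \<A> - {{}}"
  have fA: "box_family \<A>1" "box_family \<A>2"
    unfolding \<A>1_def \<A>2_def by (rule box_family_Int_halfspace[OF A k])+
  have UA: "\<Union>\<A>1 = \<Union>\<A> \<inter> {x. x \<bullet> k < c}" "\<Union>\<A>2 = \<Union>\<A> \<inter> {x. x \<bullet> k > c}"
    unfolding \<A>1_def \<A>2_def by (rule Union_image_Int_diff_empty)+
  have "K1 \<in> \<A>1" "K2 \<in> \<A>2"
    using K12 ne unfolding \<A>1_def \<A>2_def by (simp_all add: image_iff Int_absorb2) (metis Int_absorb2)+
  then have nA: "\<A>1 \<noteq> {}" "\<A>2 \<noteq> {}" by auto
  have "K2 \<inter> {x. x \<bullet> k < c} = {}" "K1 \<inter> {x. x \<bullet> k > c} = {}"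
    using K12 by force+
  then have cA: "card \<A>1 < card \<A>" "card \<A>2 < card \<A>"
    unfolding \<A>1_def \<A>2_def using card_image_Int_diff_empty_less finA K12 by metis+
  define p p1 p2 q where "p = measure lborel (\<Union>\<A>)" and "p1 = measure lborel (\<Union>\<A>1)"
    and "p2 = measure lborel (\<Union>\<A>2)" and "q = measure lborel (\<Union>\<B>)"
  have pos: "p1 > 0" "p2 > 0" "q > 0"
    unfolding p1_def p2_def q_def using fA nA B by (simp_all add: measure_Union_box_family_pos)
  have p: "p = p1 + p2"
    unfolding p_def p1_def p2_def UA
    by (rule measure_split_hyperplane[OF Union_box_family_fmeasurable[OF A] k])
  define \<alpha> where "\<alpha> = p1 / p"
  have \<alpha>: "0 < \<alpha>" "\<alpha> < 1" and p1: "p1 = \<alpha> * p" and p2: "p2 = (1 - \<alpha>) * p"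
    using pos unfolding \<alpha>_def p by (auto simp: field_simps)
  obtain d where d: "measure lborel (\<Union>\<B> \<inter> {x. x \<bullet> k < d}) = \<alpha> * measure lborel (\<Union>\<B>)"
    using cut_box_family_in_ratio[OF B(1) k, of \<alpha>] \<alpha> by auto
  define \<B>1 where "\<B>1 = (\<lambda>K. K \<inter> {x. x \<bullet> k < d}) ` \<B> - {{}}"
  define \<B>2 where "\<B>2 = (\<lambda>K. K \<inter> {x. x \<bullet> k > d}) ` \<B> - {{}}"
  have fB: "box_family \<B>1" "box_family \<B>2"
    unfolding \<B>1_def \<B>2_def by (rule box_family_Int_halfspace[OF B(1) k])+
  have UB: "\<Union>\<B>1 = \<Union>\<B> \<inter> {x. x \<bullet> k < d}" "\<Union>\<B>2 = \<Union>\<B> \<inter> {x. x \<bullet> k > d}"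
    unfolding \<B>1_def \<B>2_def by (rule Union_image_Int_diff_empty)+
  have cB: "card \<B>1 \<le> card \<B>" "card \<B>2 \<le> card \<B>"
    unfolding \<B>1_def \<B>2_def using card_image_Int_diff_empty_le[OF finB] by auto
  have q1: "measure lborel (\<Union>\<B>1) = \<alpha> * q"
    using d by (simp add: UB q_def)
  have q2: "measure lborel (\<Union>\<B>2) = (1 - \<alpha>) * q"
    using measure_split_hyperplane[OF Union_box_family_fmeasurable[OF B(1)] k, of d] d
    unfolding UB q_def by (simp add: algebra_simps)
  have nB: "\<B>1 \<noteq> {}" "\<B>2 \<noteq> {}"
    using q1 q2 pos \<alpha> by auto
  \<comment> \<open>The \<open>n\<close>-th power of a sum of \<open>n\<close>-th roots is homogeneous of degree 1 in the volumes.\<close>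
  have scale: "(root DIM('a) (s * p) + root DIM('a) (s * q)) ^ DIM('a)
      = s * (root DIM('a) p + root DIM('a) q) ^ DIM('a)" if "s \<ge> 0" for s
  proof -
    have "root DIM('a) (s * p) + root DIM('a) (s * q) = root DIM('a) s * (root DIM('a) p + root DIM('a) q)"
      by (simp add: real_root_mult algebra_simps)
    with that show ?thesis by (simp add: power_mult_distrib)
  qed
  have ineq1: "\<alpha> * (root DIM('a) p + root DIM('a) q) ^ DIM('a) \<le> measure lborel (\<Union>\<A>1 + \<Union>\<B>1)"
    using IH[OF fA(1) nA(1) fB(1) nB(1)] cA cB scale[of \<alpha>] \<alpha>
    by (simp add: q1 p1_def[symmetric] p1)
  have ineq2: "(1 - \<alpha>) * (root DIM('a) p + root DIM('a) q) ^ DIM('a) \<le> measure lborel (\<Union>\<A>2 + \<Union>\<B>2)"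
    using IH[OF fA(2) nA(2) fB(2) nB(2)] cA cB scale[of "1 - \<alpha>"] \<alpha>
    by (simp add: q2 p2_def[symmetric] p2)
  have open_sum: "open (\<Union>\<A>' + \<Union>\<B>')" if "box_family \<A>'" for \<A>' \<B>' :: "'a set set"
    using that by (intro open_set_plus open_Union_box_family)
  have AB: "\<Union>\<A> + \<Union>\<B> \<in> fmeasurable lborel"
    using A B by (intro open_bounded_fmeasurable_lborel open_sum)
      (simp_all add: set_plus_image bounded_plus bounded_Union_box_family)
  have sub: "\<Union>\<A>1 + \<Union>\<B>1 \<subseteq> (\<Union>\<A> + \<Union>\<B>) \<inter> {x. x \<bullet> k < c + d}"
    "\<Union>\<A>2 + \<Union>\<B>2 \<subseteq> (\<Union>\<A> + \<Union>\<B>) \<inter> {x. x \<bullet> k > c + d}"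
    unfolding UA UB by (auto simp: inner_add_left intro!: add_strict_mono elim!: set_plus_elim)
  have "measure lborel (\<Union>\<A>1 + \<Union>\<B>1) \<le> measure lborel ((\<Union>\<A> + \<Union>\<B>) \<inter> {x. x \<bullet> k < c + d})"
    "measure lborel (\<Union>\<A>2 + \<Union>\<B>2) \<le> measure lborel ((\<Union>\<A> + \<Union>\<B>) \<inter> {x. x \<bullet> k > c + d})"
    using sub AB open_sum fA by (auto intro!: measure_mono_fmeasurable fmeasurable_Int_fmeasurable)
  then have "measure lborel (\<Union>\<A>1 + \<Union>\<B>1) + measure lborel (\<Union>\<A>2 + \<Union>\<B>2)
      \<le> measure lborel (\<Union>\<A> + \<Union>\<B>)"
    using measure_split_hyperplane[OF AB k, of "c + d"] by simp
  with ineq1 ineq2 have "(root DIM('a) p + root DIM('a) q) ^ DIM('a) \<le> measure lborel (\<Union>\<A> + \<Union>\<B>)"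
    by (simp add: algebra_simps)
  then show ?thesis
    by (simp add: p_def q_def)
qed

theorem brunn_minkowski_box_family:
  fixes \<A> \<B> :: "'a::euclidean_space set set"
  assumes "box_family \<A>" "\<A> \<noteq> {}" "box_family \<B>" "\<B> \<noteq> {}"
  shows "(root DIM('a) (measure lborel (\<Union>\<A>)) + root DIM('a) (measure lborel (\<Union>\<B>))) ^ DIM('a)
        \<le> measure lborel (\<Union>\<A> + \<Union>\<B>)"
  using assms
proof (induction "card \<A> + card \<B>" arbitrary: \<A> \<B> rule: less_induct)
  case less
  have fin: "finite \<A>" "finite \<B>" using less.prems by (auto simp: box_family_def)
  then have "card \<A> > 0" "card \<B> > 0" using less.prems by (auto simp: card_gt_0_iff)
  then consider "card \<A> \<ge> 2" | "card \<B> \<ge> 2" | "card \<A> = 1" "card \<B> = 1" by linarith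
  then show ?case
  proof cases
    case 1
    show ?thesis
      by (rule brunn_minkowski_box_family_step[OF less.prems(1,3,4) 1]) (rule less.hyps)
  next
    case 2
    have "(root DIM('a) (measure lborel (\<Union>\<B>)) + root DIM('a) (measure lborel (\<Union>\<A>))) ^ DIM('a)
        \<le> measure lborel (\<Union>\<B> + \<Union>\<A>)"
      by (rule brunn_minkowski_box_family_step[OF less.prems(3,1,2) 2]) (rule less.hyps, simp_all)
    then show ?thesis by (simp only: add.commute)
  next
    case 3
    then obtain K L where "\<A> = {K}" "\<B> = {L}" by (auto simp: card_1_singleton_iff)
    moreover obtain a b where "K = box a b" "box a b \<noteq> {}"
      using box_familyE[OF less.prems(1), of K] \<open>\<A> = {K}\<close> by auto
    moreover obtain c d where "L = box c d" "box c d \<noteq> {}"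
      using box_familyE[OF less.prems(3), of L] \<open>\<B> = {L}\<close> by auto
    moreover have "(root DIM('a) (measure lborel (box a b)) + root DIM('a) (measure lborel (box c d))) ^ DIM('a)
        \<le> root DIM('a) (measure lborel (box a b + box c d)) ^ DIM('a)"
      using brunn_minkowski_box[OF calculation(4,6)] by (intro power_mono) (auto simp: add_nonneg_nonneg)
    ultimately show ?thesis
      by simp
  qed
qed

text \<open>An open set is a countable union of closed boxes, and finitely many of them exhaust its volume up to an
arbitrarily small error. Their union is subdivided into boxes with disjoint interiors; passing to the
interiors loses only a null set.\<close>
lemma open_box_family_approx:
  fixes S :: "'a::euclidean_space set"
  assumes "open S" "S \<in> fmeasurable lborel" "m < measure lborel S"
  obtains \<D> where "box_family \<D>" "\<Union>\<D> \<subseteq> S" "m < measure lborel (\<Union>\<D>)"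
proof -
  obtain \<C> where \<C>: "countable \<C>" "\<C> \<subseteq> Pow S" "\<And>X. X \<in> \<C> \<Longrightarrow> \<exists>a b. X = cbox a b" "\<Union>\<C> = S"
    using open_countable_Union_open_cbox[OF assms(1)] by metis
  have UC: "\<Union>\<F> \<in> sets borel" if "\<F> \<subseteq> \<C>" "finite \<F>" for \<F>
    using that \<C>(3) by (intro sets.finite_Union) (auto, metis cbox_borel in_mono)
  obtain \<F> where \<F>: "\<F> \<subseteq> \<C>" "finite \<F>"
    "measure lebesgue (\<Union>\<C>) - (measure lborel S - m) < measure lebesgue (\<Union>\<F>)"
  proof (rule measure_countable_Union_approachable[OF \<C>(1)])
    show "measure lborel S - m > 0" using assms by simp
    show "C \<in> lmeasurable" if "C \<in> \<C>" for C using \<C>(3)[OF that] by auto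
    show "measure lebesgue (\<Union>\<F>) \<le> measure lborel S" if "\<F> \<subseteq> \<C>" "finite \<F>" for \<F>
    proof -
      have "measure lborel (\<Union>\<F>) \<le> measure lborel S"
        using that UC[OF that] assms \<C>(4) by (intro measure_mono_fmeasurable) auto
      then show ?thesis using UC[OF that] by simp
    qed
  qed
  have "m < measure lborel (\<Union>\<F>)"
    using \<F> UC[OF \<F>(1,2)] assms(1) \<C>(4) by simp
  have "\<exists>a b. X = cbox a b" if "X \<in> \<F>" for X
    using \<F> \<C> that by blast
  then obtain p where p: "p division_of \<Union>\<F>"
    using elementary_unions_intervals[OF \<F>(2)] by metis
  note pD = division_ofD[OF p]
  define \<D> where "\<D> = interior ` p - {{}}"
  have "box_family \<D>"
    unfolding box_family_def
  proof (intro conjI ballI)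
    show "finite \<D>" using pD(1) by (simp add: \<D>_def)
    show "disjoint \<D>"
    proof (rule disjointI)
      fix K L assume "K \<in> \<D>" "L \<in> \<D>" "K \<noteq> L"
      then obtain K' L' where "K' \<in> p" "L' \<in> p" "K = interior K'" "L = interior L'"
        by (auto simp: \<D>_def)
      with \<open>K \<noteq> L\<close> pD(5)[of K' L'] show "K \<inter> L = {}" by metis
    qed
    fix K assume K: "K \<in> \<D>"
    then obtain K' where "K' \<in> p" "K = interior K'" by (auto simp: \<D>_def)
    with pD(4)[of K'] show "\<exists>a b. K = box a b" by (metis interior_cbox)
    from K show "K \<noteq> {}" by (simp add: \<D>_def)
  qed
  moreover have U: "\<Union>\<D> = (\<Union>K\<in>p. interior K)"
    by (auto simp: \<D>_def)
  then have "\<Union>\<D> \<subseteq> S"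
    using pD(2) interior_subset \<F>(1) \<C>(4) by (smt (verit) UN_subset_iff Union_mono subset_trans)
  moreover have "measure lborel (\<Union>\<F>) \<le> measure lborel (\<Union>\<D>)"
  proof -
    have "measure lborel (\<Union>\<F>) \<le> (\<Sum>K\<in>p. measure lborel K)"
      using measure_UNION_le[OF pD(1), of "\<lambda>K. K" lborel] pD(4,6) by fastforce
    also have "\<dots> = (\<Sum>K\<in>p. measure lborel (interior K))"
    proof (intro sum.cong refl)
      fix K assume "K \<in> p"
      then obtain a b where "K = cbox a b" using pD(4) by blast
      then show "measure lborel K = measure lborel (interior K)"
        by (simp add: interior_cbox measure_lborel_box_eq measure_lborel_cbox_eq)
    qed
    also have "\<dots> = measure lborel (\<Union>K\<in>p. interior K)"
    proof (rule measure_finite_Union[symmetric, OF pD(1)])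
      show "interior ` p \<subseteq> sets lborel" by auto
      show "disjoint_family_on interior p" using pD(5) by (auto simp: disjoint_family_on_def)
      fix K assume "K \<in> p"
      then obtain a b where "K = cbox a b" using pD(4) by blast
      then show "emeasure lborel (interior K) \<noteq> \<infinity>"
        using emeasure_lborel_box_finite[of a b] by (simp add: interior_cbox)
    qed
    finally show ?thesis by (simp add: U)
  qed
  ultimately show ?thesis
    using that \<open>m < measure lborel (\<Union>\<F>)\<close> by force
qed

lemma measure_open_pos:
  fixes S :: "'a::euclidean_space set"
  assumes "open S" "S \<noteq> {}" "S \<in> fmeasurable lborel"
  shows "measure lborel S > 0"
proof -
  obtain x r where "r > 0" "ball x r \<subseteq> S"
    using assms open_contains_ball by blast
  then have "0 < measure lborel (ball x r)" by (simp add: content_ball_pos)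
  also have "\<dots> \<le> measure lborel S"
    using \<open>ball x r \<subseteq> S\<close> assms by (intro measure_mono_fmeasurable) auto
  finally show ?thesis .
qed

text \<open>Both sets are exhausted from inside by families of boxes; their sums stay inside \<open>A + B\<close>.\<close>
theorem brunn_minkowski_open:
  fixes A B :: "'a::euclidean_space set"
  assumes A: "open A" "A \<noteq> {}" "A \<in> fmeasurable lborel"
    and B: "open B" "B \<noteq> {}" "B \<in> fmeasurable lborel"
    and AB: "A + B \<in> fmeasurable lborel"
  shows "root DIM('a) (measure lborel A) + root DIM('a) (measure lborel B)
    \<le> root DIM('a) (measure lborel (A + B))"
proof (rule ccontr)
  let ?r = "\<lambda>S::'a set. root DIM('a) (measure lborel S)"
  have approx: "\<exists>\<D>. box_family \<D> \<and> \<D> \<noteq> {} \<and> \<Union>\<D> \<subseteq> S \<and> x < ?r (\<Union>\<D>)"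
    if S: "open S" "S \<noteq> {}" "S \<in> fmeasurable lborel" and x: "x < ?r S" for S x
  proof -
    \<comment> \<open>Replacing \<open>x\<close> by \<open>max 0 x\<close> makes the \<open>n\<close>-th power monotone and forces the family to be nonempty.\<close>
    have "max 0 x < ?r S"
      using x measure_open_pos[OF S] by simp
    then have "max 0 x ^ DIM('a) < ?r S ^ DIM('a)"
      by (intro power_strict_mono) auto
    then have "max 0 x ^ DIM('a) < measure lborel S" by simp
    from open_box_family_approx[OF S(1,3) this]
    obtain \<D> where D: "box_family \<D>" "\<Union>\<D> \<subseteq> S" "max 0 x ^ DIM('a) < measure lborel (\<Union>\<D>)" .
    have "0 \<le> max 0 x ^ DIM('a)" by simp
    with D(3) have "\<D> \<noteq> {}" by auto
    have "max 0 x = root DIM('a) (max 0 x ^ DIM('a))"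
      by (simp add: real_root_power_cancel)
    also have "\<dots> < ?r (\<Union>\<D>)" using D(3) by simp
    finally show ?thesis using D \<open>\<D> \<noteq> {}\<close> by auto
  qed
  assume less: "\<not> ?r A + ?r B \<le> ?r (A + B)"
  define e where "e = (?r A + ?r B - ?r (A + B)) / 2"
  have e: "e > 0" using less by (simp add: e_def)
  obtain \<A> where \<A>: "box_family \<A>" "\<A> \<noteq> {}" "\<Union>\<A> \<subseteq> A" "?r A - e < ?r (\<Union>\<A>)"
    using approx[OF A, of "?r A - e"] e by auto
  obtain \<B> where \<B>: "box_family \<B>" "\<B> \<noteq> {}" "\<Union>\<B> \<subseteq> B" "?r B - e < ?r (\<Union>\<B>)"
    using approx[OF B, of "?r B - e"] e by auto
  have "(?r (\<Union>\<A>) + ?r (\<Union>\<B>)) ^ DIM('a) \<le> measure lborel (\<Union>\<A> + \<Union>\<B>)"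
    by (rule brunn_minkowski_box_family[OF \<A>(1,2) \<B>(1,2)])
  also have "\<dots> \<le> measure lborel (A + B)"
    using AB \<A> \<B> open_set_plus[OF open_Union_box_family[OF \<A>(1)]]
    by (intro measure_mono_fmeasurable set_plus_mono2) auto
  finally have "root DIM('a) ((?r (\<Union>\<A>) + ?r (\<Union>\<B>)) ^ DIM('a)) \<le> ?r (A + B)"
    by simp
  then have "?r (\<Union>\<A>) + ?r (\<Union>\<B>) \<le> ?r (A + B)"
    by (simp add: real_root_power_cancel add_nonneg_nonneg)
  with \<A>(4) \<B>(4) show False by (simp add: e_def field_simps)
qed

text \<open>Among the sets of a given volume, a ball has the smallest neighbourhoods. This is Brunn--Minkowski with a
ball as second summand: the roots of the volumes of balls centred at the origin are proportional to their
radii, so for balls the inequality is an equality.\<close>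
theorem emeasure_ball_add_le_emeasure_set_plus_cball:
  fixes A :: "'a::euclidean_space set"
  assumes A: "open A" "A \<noteq> {}" and eq: "emeasure lborel A = emeasure lborel (ball (0::'a) R)"
    and R: "R \<ge> 0" and d: "d \<ge> 0"
  shows "emeasure lborel (ball (0::'a) (R + d)) \<le> emeasure lborel (A + cball 0 d)"
proof (cases "d = 0 \<or> emeasure lborel (A + cball 0 d) = \<infinity>")
  case True
  moreover have "A + cball 0 0 = A" by (auto simp: set_plus_def)
  ultimately show ?thesis using eq by auto
next
  case False
  then have d: "d > 0" and fin: "A + cball 0 d \<in> fmeasurable lborel"
    using d A by (auto simp: fmeasurable_def open_set_plus top.not_eq_extremum)
  let ?c = "unit_ball_vol (real DIM('a))"
  have root_ball: "root DIM('a) (measure lborel (ball (0::'a) r)) = root DIM('a) ?c * r" if "r \<ge> 0" for r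
    using that by (simp add: content_ball real_root_mult real_root_power_cancel)
  have Afin: "A \<in> fmeasurable lborel"
    using A eq emeasure_lborel_ball_finite[of "0::'a" R] by (auto simp: fmeasurable_def)
  have sub: "A + ball 0 d \<subseteq> A + cball 0 d"
    by (intro set_plus_mono2) auto
  have meas: "A + ball 0 d \<in> sets lborel"
    using open_set_plus[OF A(1)] by simp
  have "root DIM('a) ?c * (R + d)
      = root DIM('a) (measure lborel A) + root DIM('a) (measure lborel (ball (0::'a) d))"
    using R d eq root_ball by (simp add: measure_def distrib_left)
  also have "\<dots> \<le> root DIM('a) (measure lborel (A + ball 0 d))"
    using A Afin d fmeasurableI2[OF fin sub meas] emeasure_lborel_ball_finite[of "0::'a" d]
    by (intro brunn_minkowski_open) (auto simp: fmeasurable_def)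
  also have "\<dots> \<le> root DIM('a) (measure lborel (A + cball 0 d))"
    using sub meas fin by (simp add: measure_mono_fmeasurable)
  finally have "root DIM('a) (measure lborel (ball (0::'a) (R + d)))
      \<le> root DIM('a) (measure lborel (A + cball 0 d))"
    using root_ball[of "R + d"] R d by simp
  then have "measure lborel (ball (0::'a) (R + d)) \<le> measure lborel (A + cball 0 d)"
    by simp
  moreover have "ball (0::'a) (R + d) \<in> fmeasurable lborel"
    by (simp add: open_bounded_fmeasurable_lborel)
  ultimately show ?thesis
    using fin by (simp add: emeasure_eq_measure2 ennreal_leI)
qed

section \<open>Rearrangements of sets and functions\<close>
lemma emeasure_ball_inj:
  assumes "0 \<le> r" "0 \<le> s" "emeasure lebesgue (ball (0::'a::euclidean_space) r) = emeasure lebesgue (ball (0::'a) s)"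
  shows "r = s"
proof -
  have "unit_ball_vol (real DIM('a)) * r ^ DIM('a) = unit_ball_vol (real DIM('a)) * s ^ DIM('a)"
    using assms by (simp add: emeasure_ball ennreal_inj)
  then have "r ^ DIM('a) = s ^ DIM('a)"
    using less_imp_neq[OF unit_ball_vol_pos[of "real DIM('a)"]] by auto
  then show ?thesis
    using assms(1,2) by (simp add: power_eq_iff_eq_base)
qed

lemma set_rearrangement_finite:
  fixes A :: "'a::euclidean_space set"
  assumes fin: "emeasure lebesgue A \<noteq> \<infinity>"
  obtains r where "r \<ge> 0" "set_rearrangement A = ball 0 r"
    "emeasure lebesgue (ball (0::'a) r) = emeasure lebesgue A"
proof -
  let ?c = "unit_ball_vol (real DIM('a))"
  define r where "r = root DIM('a) (enn2real (emeasure lebesgue A) / ?c)"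
  have r: "r \<ge> 0" by (simp add: r_def)
  have "emeasure lebesgue (ball (0::'a) r) = ennreal (enn2real (emeasure lebesgue A))"
    using r less_imp_neq[OF unit_ball_vol_pos[of "real DIM('a)"]] by (simp add: emeasure_ball r_def)
  also have "\<dots> = emeasure lebesgue A"
    using fin by (simp add: less_top)
  finally have eq: "emeasure lebesgue (ball (0::'a) r) = emeasure lebesgue A" .
  have "(THE r. 0 \<le> r \<and> emeasure lebesgue (ball (0::'a) r) = emeasure lebesgue A) = r"
    using r eq by (intro the_equality) (auto intro!: emeasure_ball_inj[where 'a = 'a])
  with fin r eq that show ?thesis
    by (simp add: set_rearrangement_def)
qed

lemma emeasure_set_rearrangement:
  "emeasure lebesgue (set_rearrangement A) = emeasure lebesgue A"
proof (cases "emeasure lebesgue A = \<infinity>")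
  case True
  then show ?thesis by (simp add: set_rearrangement_def)
next
  case False
  then show ?thesis by (metis set_rearrangement_finite)
qed

text \<open>Balls centred at the origin are nested, so their volumes decide membership in a rearranged set. This
bounds a rearrangement from below pointwise.\<close>
lemma in_set_rearrangementI:
  fixes x :: "'a::euclidean_space"
  assumes "norm x < r" "emeasure lebesgue (ball (0::'a) r) \<le> emeasure lebesgue A"
  shows "x \<in> set_rearrangement A"
proof (cases "emeasure lebesgue A = \<infinity>")
  case True
  then show ?thesis by (simp add: set_rearrangement_def)
next
  case False
  then obtain s where s: "s \<ge> 0" "set_rearrangement A = ball 0 s"
    "emeasure lebesgue (ball (0::'a) s) = emeasure lebesgue A"
    by (rule set_rearrangement_finite)
  have "r \<ge> 0" using assms(1) norm_ge_zero[of x] by linarith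
  have "r \<le> s"
  proof (rule ccontr)
    assume "\<not> r \<le> s"
    then have "ball (0::'a) s \<subseteq> ball 0 r" by (intro subset_ball) simp
    then have "emeasure lebesgue (ball (0::'a) s) = emeasure lebesgue (ball (0::'a) r)"
    proof (intro antisym)
      show "emeasure lebesgue (ball (0::'a) r) \<le> emeasure lebesgue (ball (0::'a) s)"
        using assms(2) s(3) by simp
    qed (rule emeasure_mono, auto)
    then have "s = r"
      by (rule emeasure_ball_inj[OF s(1) \<open>r \<ge> 0\<close>])
    with \<open>\<not> r \<le> s\<close> show False by simp
  qed
  with assms(1) s(2) show ?thesis by simp
qed

lemma set_rearrangement_mono:
  assumes "A \<subseteq> B" "B \<in> sets lebesgue"
  shows "set_rearrangement A \<subseteq> set_rearrangement B"
proof (cases "emeasure lebesgue A = \<infinity>")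
  case True
  then have "emeasure lebesgue B = \<infinity>"
    using emeasure_mono[OF assms] by (simp add: top.extremum_unique)
  then show ?thesis by (simp add: set_rearrangement_def)
next
  case False
  then obtain s where s: "set_rearrangement A = ball 0 s"
    "emeasure lebesgue (ball (0::'a) s) = emeasure lebesgue A"
    by (metis set_rearrangement_finite)
  show ?thesis
    unfolding s(1) using emeasure_mono[OF assms] s(2)
    by (auto intro!: in_set_rearrangementI[where r = s])
qed

text \<open>If \<open>y\<close> lies outside the rearrangement of \<open>{f < l}\<close>, it lies outside the rearrangement of every
\<open>{exp (- f) > s}\<close> with \<open>s \<ge> exp (- l)\<close>, because these sets are contained in \<open>{f < l}\<close>. The layer-cake
integral at \<open>y\<close> then extends at most over \<open>s < exp (- l)\<close>. Its
value is therefore at most \<open>exp (- l)\<close>, that is, \<open>f\<^sub>* y \<ge> l\<close>.\<close>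
lemma increasing_rearrangement_less_imp:
  fixes f :: "'a::euclidean_space \<Rightarrow> real"
  assumes f: "continuous_on UNIV f" and less: "increasing_rearrangement f y < ereal l"
  shows "y \<in> set_rearrangement {x. f x < l}"
proof (rule ccontr)
  assume y: "y \<notin> set_rearrangement {x. f x < l}"
  have "open {x. f x < l}"
    using f by (intro open_Collect_less) auto
  then have meas: "{x. f x < l} \<in> sets lebesgue" by simp
  let ?S = "\<lambda>s. set_rearrangement {x. ennreal (exp (- f x)) > ennreal s}"
  have "y \<notin> ?S s" if "s \<ge> exp (- l)" for s
  proof -
    have "{x. ennreal (exp (- f x)) > ennreal s} \<subseteq> {x. f x < l}"
    proof clarify
      fix x assume "ennreal s < ennreal (exp (- f x))"
      moreover have "s \<ge> 0" using that exp_gt_zero[of "-l"] by linarith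
      ultimately have "s < exp (- f x)"
        by (simp add: ennreal_less_iff)
      with that have "exp (- l) < exp (- f x)"
        by (rule le_less_trans)
      then show "f x < l" by simp
    qed
    with y meas show ?thesis using set_rearrangement_mono by blast
  qed
  then have "decreasing_rearrangement (\<lambda>x. ennreal (exp (- f x))) y
      \<le> (\<integral>\<^sup>+s. indicator {0<..<exp (-l)} s \<partial>lborel)"
    unfolding decreasing_rearrangement_def
    by (intro nn_integral_mono) (auto split: split_indicator simp: not_less not_le)
  also have "\<dots> = ennreal (exp (- l))"
    by simp
  finally have le: "decreasing_rearrangement (\<lambda>x. ennreal (exp (- f x))) y \<le> ennreal (exp (- l))" .
  have "ereal l \<le> neg_ln a" if "a \<le> ennreal (exp (- l))" for a
  proof (cases a)
    case (real r)
    show ?thesis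
    proof (cases "r = 0")
      case False
      with real that have "r \<le> exp (- l)" "r > 0" by (auto simp: ennreal_le_iff)
      then have "ln r \<le> - l" by (metis ln_exp ln_mono exp_gt_zero)
      with real False \<open>r > 0\<close> show ?thesis by (simp add: neg_ln_def)
    qed (simp add: neg_ln_def real)
  next
    case top
    with that show ?thesis by (simp add: top_unique)
  qed
  with le less show False
    unfolding increasing_rearrangement_def by (meson not_less)
qed

section \<open>Sublevel sets of Hopf--Lax solutions\<close>
lemma legendre_transform_mono: "r \<le> r' \<Longrightarrow> legendre_transform H r \<le> legendre_transform H r'"
  unfolding legendre_transform_def by (intro SUP_mono) (auto intro!: bexI mult_right_mono)

lemma legendre_transform_gt_minf: "legendre_transform H r > - \<infinity>"
proof -
  have "ereal (r * 0 - H 0) \<le> legendre_transform H r"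
    unfolding legendre_transform_def by (intro SUP_upper) simp
  then show ?thesis by auto
qed

text \<open>The level \<open>l\<close> is split into a level \<open>m\<close> for the datum at a nearly optimal point \<open>y\<close> and the cost of the move
from \<open>y\<close> to \<open>x\<close>. The cost depends on the distance only and does not decrease with it, so every move that is
no longer, from any point where any datum is below \<open>m\<close>, ends below \<open>l\<close>. Quantifying over the datum
allows the levels found for \<open>f\<^sub>*\<close> to be used for \<open>f\<close>.\<close>
lemma hopf_lax_less_imp_ball:
  fixes g :: "'a::euclidean_space \<Rightarrow> ereal"
  assumes t: "t > 0" and less: "hopf_lax H t g x < ereal l"
  shows "\<exists>y m. g y < ereal m \<and>
    (\<forall>g' a z. norm z \<le> norm (x - y) \<longrightarrow> g' a < ereal m \<longrightarrow> hopf_lax H t g' (a + z :: 'a) < ereal l)"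
proof -
  let ?c = "\<lambda>r. ereal t * legendre_transform H (r / t)"
  obtain y where y: "g y + ?c (norm (x - y)) < ereal l"
    using less t by (auto simp: hopf_lax_def INF_less_iff)
  \<comment> \<open>In the extended reals \<open>- \<infinity> + \<infinity> = \<infinity>\<close>, so an infinite cost would contradict \<open>y\<close> even when
    \<open>g y = - \<infinity>\<close>.\<close>
  have "?c (norm (x - y)) \<noteq> \<infinity>" using y by auto
  moreover have "?c (norm (x - y)) \<noteq> -\<infinity>"
    using t legendre_transform_gt_minf[of H "norm (x - y) / t"] by (cases "legendre_transform H (norm (x - y) / t)") auto
  ultimately obtain \<tau> where \<tau>: "?c (norm (x - y)) = ereal \<tau>"
    by (cases "?c (norm (x - y))") auto
  show ?thesis
  proof (intro exI conjI allI impI)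
    show "g y < ereal (l - \<tau>)"
      using y \<tau> by (cases "g y") auto
    fix g' :: "'a \<Rightarrow> ereal" and a z :: 'a
    assume z: "norm z \<le> norm (x - y)" and a: "g' a < ereal (l - \<tau>)"
    have "hopf_lax H t g' (a + z) = (INF b. g' b + ?c (norm (a + z - b)))"
      using t by (simp add: hopf_lax_def)
    also have "\<dots> \<le> g' a + ?c (norm (a + z - a))"
      by (rule INF_lower) simp
    also have "\<dots> \<le> g' a + ?c (norm (x - y))"
      using t z by (intro add_left_mono ereal_mult_left_mono legendre_transform_mono divide_right_mono) auto
    also have "\<dots> < ereal l"
      using a unfolding \<tau> by (cases "g' a") auto
    finally show "hopf_lax H t g' (a + z) < ereal l" .
  qed
qed

text \<open>Let \<open>x\<close> be in the sublevel set of \<open>v\<close>, reached from \<open>y\<close> by a move of length \<open>d\<close>, with \<open>f\<^sub>* y < m\<close>. Then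
\<open>y\<close> lies in the rearrangement of \<open>A = {f < m}\<close>, a centred ball of some radius \<open>R\<close> if \<open>A\<close> has
finite volume, so \<open>x\<close> lies in the centred ball of radius \<open>R + d\<close>. The sublevel set of \<open>u\<close> contains the \<open>d\<close>-neighbourhood of \<open>A\<close>, whose volume is at least that of
this ball. If \<open>A\<close> has infinite volume, so has the larger sublevel set of \<open>u\<close>, whose rearrangement
is then the whole space. The inclusion of sets, rather than a comparison of volumes, avoids a limit over the
levels \<open>m\<close>.\<close>
lemma hopf_lax_sublevel_subset_rearrangement:
  fixes f :: "'a::euclidean_space \<Rightarrow> real"
  assumes f: "continuous_on UNIV f" and t: "t \<ge> 0"
  shows "{x. hopf_lax H t (increasing_rearrangement f) x < ereal l}
    \<subseteq> set_rearrangement {x. hopf_lax H t (\<lambda>y. ereal (f y)) x < ereal l}"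
proof (cases "t = 0")
  case True
  then show ?thesis
    using increasing_rearrangement_less_imp[OF f] by (auto simp: hopf_lax_def)
next
  case False
  with t have t: "t > 0" by simp
  define U where "U = {x. hopf_lax H t (\<lambda>y. ereal (f y)) x < ereal l}"
  have op: "open {x. f x < m}" for m
    using f by (intro open_Collect_less) auto
  have "open U"
  proof (subst open_subopen, intro ballI)
    fix x assume "x \<in> U"
    then have "hopf_lax H t (\<lambda>y. ereal (f y)) x < ereal l" by (simp add: U_def)
    from hopf_lax_less_imp_ball[OF t this] obtain y m where y: "ereal (f y) < ereal m"
      and *: "\<forall>g' a z. norm z \<le> norm (x - y) \<longrightarrow> g' a < ereal m \<longrightarrow> hopf_lax H t g' (a + z :: 'a) < ereal l"
      by blast
    have "{x. f x < m} + {x - y} \<subseteq> U"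
      using * by (auto simp: U_def set_plus_def)
    moreover have "x \<in> {x. f x < m} + {x - y}"
      using y by (auto simp: set_plus_def intro!: exI[of _ y])
    ultimately show "\<exists>T. open T \<and> x \<in> T \<and> T \<subseteq> U"
      using open_set_plus[OF op] by blast
  qed
  show ?thesis
    unfolding U_def[symmetric]
  proof clarify
    fix x assume "hopf_lax H t (increasing_rearrangement f) x < ereal l"
    from hopf_lax_less_imp_ball[OF t this] obtain y m where y: "increasing_rearrangement f y < ereal m"
      and *: "\<forall>g' a z. norm z \<le> norm (x - y) \<longrightarrow> g' a < ereal m \<longrightarrow> hopf_lax H t g' (a + z :: 'a) < ereal l"
      by blast
    define A where "A = {x. f x < m}"
    define d where "d = norm (x - y)"
    have oA: "open A" using op by (simp add: A_def)
    have sub: "A + cball 0 d \<subseteq> U"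
      using * by (auto simp: A_def U_def d_def set_plus_def)
    have yA: "y \<in> set_rearrangement A"
      unfolding A_def by (rule increasing_rearrangement_less_imp[OF f y])
    show "x \<in> set_rearrangement U"
    proof (cases "emeasure lebesgue A = \<infinity>")
      case True
      have "a + 0 \<in> U" if "a \<in> A" for a
        by (rule subsetD[OF sub], rule set_plus_intro[OF that]) (simp add: d_def)
      then have "A \<subseteq> U" by auto
      then have "set_rearrangement A \<subseteq> set_rearrangement U"
        using \<open>open U\<close> by (intro set_rearrangement_mono) auto
      with True show ?thesis by (auto simp: set_rearrangement_def)
    next
      case False
      then obtain R where R: "R \<ge> 0" "set_rearrangement A = ball 0 R"
        "emeasure lebesgue (ball (0::'a) R) = emeasure lebesgue A"
        by (rule set_rearrangement_finite)
      have yR: "norm y < R" using yA R by simp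
      have "A \<noteq> {}"
      proof
        assume "A = {}"
        with R(3) have "emeasure lebesgue (ball (0::'a) R) = emeasure lebesgue (ball (0::'a) 0)" by simp
        from emeasure_ball_inj[OF R(1) _ this] yR show False by simp
      qed
      show ?thesis
      proof (rule in_set_rearrangementI)
        show "norm x < R + d"
          using norm_triangle_sub[of x y] yR by (simp add: d_def)
        have "emeasure lborel (ball (0::'a) (R + d)) \<le> emeasure lborel (A + cball 0 d)"
          using R oA \<open>A \<noteq> {}\<close>
          by (intro emeasure_ball_add_le_emeasure_set_plus_cball) (auto simp: d_def)
        also have "\<dots> \<le> emeasure lborel U"
          using sub \<open>open U\<close> by (intro emeasure_mono) auto
        finally show "emeasure lebesgue (ball (0::'a) (R + d)) \<le> emeasure lebesgue U"
          using \<open>open U\<close> by simp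
      qed
    qed
  qed
qed

theorem theorem5p1:
  fixes H :: "real \<Rightarrow> real" and f :: "real ^ 'n \<Rightarrow> real" and t :: real and l :: real
  assumes "smooth_on_half_line H"
    and "convex_on {0..} H"
    and "superlinear H"
    and "\<exists>L. lipschitz_on L UNIV f"
    and "t \<ge> 0"
  shows "emeasure lebesgue {x. hopf_lax H t (increasing_rearrangement f) x < ereal l}
       \<le> emeasure lebesgue {x. hopf_lax H t (\<lambda>y. ereal (f y)) x < ereal l}"
proof -
  let ?U = "{x. hopf_lax H t (\<lambda>y. ereal (f y)) x < ereal l}"
  have "continuous_on UNIV f"
    using assms(4) lipschitz_on_continuous_on by blast
  then have "{x. hopf_lax H t (increasing_rearrangement f) x < ereal l} \<subseteq> set_rearrangement ?U"
    using assms(5) by (rule hopf_lax_sublevel_subset_rearrangement)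
  moreover have "set_rearrangement ?U \<in> sets lebesgue"
    by (simp add: set_rearrangement_def)
  ultimately have "emeasure lebesgue {x. hopf_lax H t (increasing_rearrangement f) x < ereal l}
      \<le> emeasure lebesgue (set_rearrangement ?U)"
    by (rule emeasure_mono)
  then show ?thesis
    by (simp only: emeasure_set_rearrangement)
qed

end
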